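(* For every integer $k \geq 1$, the following identity of formal power series holds: \[V_{k}=\big[(Q-1)P^{-1}\big](1-P^{-1})^{k-1}.\] Moreover, \[V_{1}=(Q-1)P^{-1}=\sum_{n=1}^{+\infty} \left(\sum_{j=0}^{\left\lfloor\frac{n-1}{3}\right\rfloor} \sum_{k=0}^{\left\lfloor\frac{n-3j-1}{3}\right\rfloor} \frac{3j+1}{n-k} \binom{n-3j-1-2k-1}{k} \binom{2n-4k-3j-2}{n-3k-3j-1}\right)X^{n}.\]
   Context: For $n\ge 1$ and integers $a_1,\ldots,a_n$, set \[M_n(a_1,\ldots,a_n):=\begin{pmatrix} a_n & -1\\ 1 & 0\end{pmatrix}\begin{pmatrix} a_{n-1} & -1\\ 1 & 0\end{pmatrix}\cdots\begin{pmatrix} a_1 & -1\\ 1 & 0\end{pmatrix}\in SL_2(\mathbb{Z}).\] A $\lambda$-quiddity of size $n$ is an $n$-tuple $(a_1,\ldots,a_n)$ of positive integers such that $M_n(a_1,\ldots,a_n)=\pm Id$. $Q_0:=1$ and, for $n\ge 1$, $Q_n$ is the number of $\lambda$-quiddities of size $n+2$; $Q:=\sum_{n\ge 0}Q_nX^n$. For $n,k\ge 1$, $V_{k,n}$ is the number of $\lambda$-quiddities of size $n+2$ whose last component equals $k$; $V_{k,0}:=0$; $V_k:=\sum_{n\ge 0}V_{k,n}X^n$. Binomial conventions: $\binom{n}{k}=0$ if $k>n\ge 0$, $\binom{n}{-1}=0$ for $n \geq 0$, and a binomial coefficient $\binom{-n}{k}$ with negative upper entry ($n\ge 1$, $k \geq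 0$) is taken to be $1$. $P_0:=1$ and, for $n\ge 1$, $P_{n}:=\sum_{k=0}^{\lfloor n/3\rfloor} \frac{1}{n-k+1} \binom{n-2k-1}{k}\binom{2n-4k}{n-3k}$. $P:=\sum_{n\ge 0} P_n X^n$, and $P^{-1}$ is the multiplicative inverse of $P$ in $\mathbb{Z}[[X]]$. *)

theory Defs
  imports "HOL-Analysis.Analysis"
begin

definition elem_mat :: "int \<Rightarrow> int^2^2" where
  "elem_mat a = vector [vector [a, -1], vector [1, 0]]"

text \<open>For \<open>[a\<^sub>1, \<dots>, a\<^sub>n]\<close> this is the reversed product
  \<open>elem_mat a\<^sub>n ** \<dots> ** elem_mat a\<^sub>1\<close>.\<close>

primrec M :: "int list \<Rightarrow> int^2^2" where
  "M [] = mat 1"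
| "M (a # as) = M as ** elem_mat a"

definition quiddity :: "int list \<Rightarrow> bool" where
  "quiddity as \<longleftrightarrow> as \<noteq> [] \<and> (\<forall>a\<in>set as. a > 0) \<and> (M as = mat 1 \<or> M as = - mat 1)"

definition Q_coeff :: "nat \<Rightarrow> nat" where
  "Q_coeff n = (if n = 0 then 1 else card {as. quiddity as \<and> length as = n + 2})"

definition V_coeff :: "nat \<Rightarrow> nat \<Rightarrow> nat" where
  "V_coeff k n = (if n = 0 then 0
     else card {as. quiddity as \<and> length as = n + 2 \<and> last as = int k})"

text \<open>The binomial coefficient is \<open>0\<close> for negative lower entry and, by a convention that differs
  from that of \<open>gchoose\<close>, \<open>1\<close> for negative upper and nonnegative lower entry.\<close>

definition binom :: "int \<Rightarrow> int \<Rightarrow> nat" where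
  "binom n k = (if k < 0 then 0 else if n < 0 then 1 else nat n choose nat k)"

definition P_coeff :: "nat \<Rightarrow> rat" where
  "P_coeff n = (if n = 0 then 1 else
     (\<Sum>k = 0..n div 3.
        1 / of_int (int n - int k + 1)
        * of_nat (binom (int n - 2 * int k - 1) (int k))
        * of_nat (binom (2 * int n - 4 * int k) (int n - 3 * int k))))"

text \<open>The power series are taken over the rationals, since the summands of \<open>P_coeff\<close> are written
  as fractions and the library's \<open>inverse\<close> on power series is not available over the integers.
  As the integral power series embed into the rational ones and \<open>P\<close> has constant term \<open>1\<close>, its
  inverse is the same in both rings.\<close>

definition Q :: "rat fps" where
  "Q = Abs_fps (\<lambda>n. of_nat (Q_coeff n))"

definition V :: "nat \<Rightarrow> rat fps" where
  "V k = Abs_fps (\<lambda>n. of_nat (V_coeff k n))"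

definition P :: "rat fps" where
  "P = Abs_fps P_coeff"

lemma P_mult_inverse: "P * inverse P = 1"
  by (rule inverse_mult_eq_1') (simp add: P_def P_coeff_def)

end

theory Submission
  imports Defs
begin

text \<open>
  Modulo sign, \<open>S = elem_mat 0\<close> and \<open>U = elem_mat 1\<close> generate the free product of cyclic groups
  of orders 2 and 3, and \<open>elem_mat a\<close> is \<open>(US)\<close> to the power \<open>a - 1\<close>, followed by \<open>U\<close>. A tuple of
  positive integers is therefore a word in \<open>U\<close> and \<open>S\<close> that begins and ends with \<open>U\<close> and has no
  two consecutive \<open>S\<close>, and a quiddity is such a word with trivial value: a closed walk on the
  Cayley graph, which is a tree of triangles (traversed by \<open>U\<close>) joined by edges (crossed by \<open>S\<close>).
  The size of the tuple is the number of letters \<open>U\<close> minus the number of letters \<open>S\<close>, so that the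
  natural weight is \<open>X\<close> for \<open>U\<close> and \<open>1/X\<close> for \<open>S\<close>.

  Let \<open>p\<close> be the generating function of what can happen at a corner of a triangle between two
  consecutive turns: nothing, or one excursion through the edge at that corner. In the neighbouring
  triangle an excursion makes \<open>3d\<close> turns for some \<open>d \<ge> 1\<close>, with a \<open>p\<close> at each intermediate corner
  other than the entry. Hence \<open>p = 1 + X p\<^sup>2 / (1 - X\<^sup>3 p\<^sup>2)\<close>. For a whole closed walk the
  starting corner admits excursions as well, which gives \<open>Q - 1 = X p\<^sup>2 / (1 - X\<^sup>3 p\<^sup>3)\<close>. The last
  component supplies the first letters, and it equals \<open>k\<close> when the walk begins with \<open>k - 1\<close> nested
  excursions, each undertaken right after the first turn of the enclosing level, and the innermost
  level has none there. Prescribing what happens at this corner removes a factor \<open>p\<close> from every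
  level, so that the outer walk contributes \<open>(Q - 1) / p\<close> and each of the \<open>k - 1\<close> excursions
  contributes \<open>(p - 1) / p\<close>; this is the formula for \<open>V k\<close>.

  Two facts turn this into a proof. First, \<open>P\<close> is the series \<open>p\<close>. The coefficients of all powers
  of \<open>p\<close> have a closed form of Lagrange type; the equation for \<open>p\<close> is a linear recurrence for the
  family of its powers, the closed forms satisfy it by Pascal's rule (\<open>coeff_term_rec\<close>), and the
  recurrence has a unique solution (\<open>linear_system_zero\<close>). Uniqueness alone makes the family
  multiplicative (\<open>lagrange_power_add\<close>), so it consists of the powers of \<open>P\<close> (\<open>P_power\<close>), and this
  also gives the explicit coefficients of \<open>V 1 = X P / (1 - X\<^sup>3 P\<^sup>3)\<close>.
  Second, the count of walks (\<open>card_walks\<close>). Rather than decomposing closed walks bijectively, it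
  counts the tuples that lead from an arbitrary vertex of the tree back to the identity; for these
  numbers the first component of the tuple gives a recurrence, and products of simple rational
  expressions in \<open>P\<close> solve it. That distinct reduced words are distinct matrices enters only in
  \<open>state_mat_trivial_iff\<close>, a ping-pong argument.
\<close>

section \<open>Integer tuples as walks in the modular group\<close>

definition eq_sign :: "int^2^2 \<Rightarrow> int^2^2 \<Rightarrow> bool" where
  "eq_sign A B \<longleftrightarrow> A = B \<or> A = - B"

lemmas mat2_entries = vec_eq_iff forall_2 matrix_matrix_mult_def sum_2 mat_def elem_mat_def

lemma minus_mult_mat: "(- A) ** B = - (A ** B)" "A ** (- B) = - (A ** B)" for A B :: "int^2^2"
  by (simp_all add: mat2_entries)

lemma eq_sign_refl [simp]: "eq_sign A A"
  by (simp add: eq_sign_def)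

lemma eq_sign_sym: "eq_sign A B \<Longrightarrow> eq_sign B A"
  by (auto simp: eq_sign_def)

lemma eq_sign_trans [trans]: "eq_sign A B \<Longrightarrow> eq_sign B C \<Longrightarrow> eq_sign A C"
  by (auto simp: eq_sign_def)

lemma eq_sign_mult_right: "eq_sign A B \<Longrightarrow> eq_sign (A ** C) (B ** C)"
  by (auto simp: eq_sign_def minus_mult_mat)

lemma eq_sign_minus_mult: "eq_sign (A ** (- B)) C \<longleftrightarrow> eq_sign (A ** B) C" for A B :: "int^2^2"
  by (auto simp: eq_sign_def minus_mult_mat)

text \<open>The list is read from its head, against the order of \<open>M\<close>: the factor of the head is the
  leftmost one, so that a walk starting at \<open>g\<close> extends on the right.\<close>
definition walks :: "int^2^2 \<Rightarrow> nat \<Rightarrow> int list set" where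
  "walks g n = {as. length as = n \<and> (\<forall>a\<in>set as. a > 0) \<and> eq_sign (g ** M (rev as)) (mat 1)}"

lemma walks_cong: "eq_sign g h \<Longrightarrow> walks g n = walks h n"
  unfolding walks_def by (blast intro: eq_sign_trans eq_sign_mult_right eq_sign_sym)

lemma M_snoc: "M (as @ [a]) = elem_mat a ** M as"
  by (induction as) (simp_all add: matrix_mul_assoc)

lemma walks_0: "walks g 0 = (if eq_sign g (mat 1) then {[]} else {})"
  by (auto simp: walks_def)

lemma Cons_in_walks: "a # as \<in> walks g (Suc n) \<longleftrightarrow> a > 0 \<and> as \<in> walks (g ** elem_mat a) n"
  by (auto simp: walks_def M_snoc matrix_mul_assoc)

lemma in_walks_Suc: "as \<in> walks g (Suc n) \<longleftrightarrow> (\<exists>a bs. as = a # bs \<and> a > 0 \<and> bs \<in> walks (g ** elem_mat a) n)"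
proof (cases as)
  case Nil then show ?thesis by (simp add: walks_def)
next
  case (Cons b bs) then show ?thesis by (simp add: Cons_in_walks)
qed

primrec turns :: "nat \<Rightarrow> int^2^2" where
  "turns 0 = mat 1"
| "turns (Suc c) = turns c ** elem_mat 1"

text \<open>The vertex \<open>U^b S \<dots> U^d S U^c\<close> of the tree is encoded as the stack \<open>[c, d, \<dots>, b]\<close>: the
  position in the current triangle, then the positions at which the enclosing triangles were left,
  down to the triangle of the identity. The empty stack is given the value \<open>S\<close>, which makes the
  recursion uniform: up to sign, its \<open>S\<close> cancels against the one contributed by the bottom entry.\<close>
primrec state_mat :: "nat list \<Rightarrow> int^2^2" where
  "state_mat [] = elem_mat 0"
| "state_mat (c # cs) = state_mat cs ** elem_mat 0 ** turns c"

definition turn :: "nat \<Rightarrow> nat" where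
  "turn c = (if c = 2 then 0 else Suc c)"

text \<open>Below the top, an entry \<open>0\<close> would mean leaving a triangle through the edge by which it was
  entered. Only the bottom triangle, which was not entered through an edge, may be left at \<open>0\<close>.\<close>
definition reduced :: "nat list \<Rightarrow> bool" where
  "reduced s \<longleftrightarrow> s \<noteq> [] \<and> set s \<subseteq> {..<3} \<and> 0 \<notin> set (butlast (tl s))"

lemma turns_3: "turns 2 ** elem_mat 1 = - turns 0"
  by (simp add: numeral_2_eq_2) (simp add: mat2_entries)

lemma elem_mat_Suc: "elem_mat (a + 1) = - (elem_mat a ** elem_mat 0 ** elem_mat 1)"
  "elem_mat (a + 1) = - (elem_mat 1 ** elem_mat 0 ** elem_mat a)"
  by (simp_all add: mat2_entries)

lemma elem_mat_0_square: "elem_mat 0 ** elem_mat 0 = - mat 1"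
  by (simp add: mat2_entries)

lemma state_mat_turn: "eq_sign (state_mat (c # cs) ** elem_mat 1) (state_mat (turn c # cs))"
proof (cases "c = 2")
  case True
  then have "state_mat (c # cs) ** elem_mat 1 = state_mat cs ** elem_mat 0 ** (turns 2 ** elem_mat 1)"
    by (simp add: matrix_mul_assoc)
  then show ?thesis unfolding turns_3 by (simp add: True turn_def eq_sign_def minus_mult_mat)
next
  case False then show ?thesis by (simp add: turn_def matrix_mul_assoc)
qed

text \<open>One turn, then \<open>j\<close> times: cross the edge and turn in the new triangle, which leaves it at
  position \<open>1\<close> each time.\<close>
lemma state_mat_descend:
  "eq_sign (state_mat (c # cs) ** elem_mat (int (Suc j))) (state_mat (replicate j 1 @ turn c # cs))"
proof (induction j)
  case 0 then show ?case using state_mat_turn by simp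
next
  case (Suc j)
  have e: "int (Suc (Suc j)) = int (Suc j) + 1" by simp
  have "eq_sign (state_mat (c # cs) ** elem_mat (int (Suc (Suc j))))
     (state_mat (c # cs) ** elem_mat (int (Suc j)) ** (elem_mat 0 ** elem_mat 1))"
    unfolding e elem_mat_Suc(1) eq_sign_minus_mult by (simp add: matrix_mul_assoc)
  also have "eq_sign \<dots> (state_mat (replicate j 1 @ turn c # cs) ** (elem_mat 0 ** elem_mat 1))"
    by (rule eq_sign_mult_right[OF Suc.IH])
  also have "\<dots> = state_mat (replicate (Suc j) 1 @ turn c # cs)"
    by (simp add: matrix_mul_assoc)
  finally show ?case .
qed

text \<open>The third turn returns to the entry of the triangle, and the first \<open>S\<close> crosses the entry edge
  backwards; what is left of the component is a component of the enclosing triangle. Seen from the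
  latter, the excursion has increased that component by one.\<close>
lemma state_mat_pop: "eq_sign (state_mat (2 # s) ** elem_mat (a + 1)) (state_mat s ** elem_mat a)"
proof -
  have "state_mat (2 # s) ** elem_mat (a + 1)
      = - (state_mat s ** (elem_mat 0 ** (turns 2 ** elem_mat 1) ** elem_mat 0) ** elem_mat a)"
    unfolding elem_mat_Suc(2) by (simp add: matrix_mul_assoc minus_mult_mat)
  also have "elem_mat 0 ** (turns 2 ** elem_mat 1) ** elem_mat 0 = mat 1"
    unfolding turns_3 by (simp add: minus_mult_mat elem_mat_0_square)
  finally show ?thesis by (simp add: eq_sign_def)
qed

definition norm1 :: "int^2 \<Rightarrow> int" where
  "norm1 v = \<bar>v $ 1\<bar> + \<bar>v $ 2\<bar>"

lemmas vec2_entries = matrix_vector_mult_def sum_2 mat_def elem_mat_def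

lemma norm1_eq_sign: "eq_sign A (mat 1) \<Longrightarrow> norm1 (A *v v) = norm1 v"
  unfolding eq_sign_def norm1_def by (auto simp: vec2_entries)

text \<open>Ping-pong: \<open>S\<close> maps vectors with coordinates of equal sign to vectors with coordinates of
  opposite sign, and \<open>U\<close> and \<open>U\<^sup>2\<close> map those back. Tracking the norm as well settles words that
  start or end with \<open>S\<close> without conjugating them.\<close>
lemma turns_expands:
  assumes "v $ 1 * v $ 2 > 0" "c \<in> {1, 2}"
  defines "w \<equiv> turns c *v (elem_mat 0 *v v)"
  shows "w $ 1 * w $ 2 > 0" "norm1 w > norm1 v"
proof -
  have s: "v $ 1 > 0 \<and> v $ 2 > 0 \<or> v $ 1 < 0 \<and> v $ 2 < 0"
    using assms(1) by (simp add: zero_less_mult_iff)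
  have w: "w $ 1 = - (v $ 1 + v $ 2) \<and> w $ 2 = - v $ 2 \<or> w $ 1 = - v $ 1 \<and> w $ 2 = - (v $ 1 + v $ 2)"
    using assms(2) unfolding w_def by (auto simp: numeral_2_eq_2 vec2_entries matrix_matrix_mult_def)
  show "norm1 w > norm1 v" using s w by (auto simp: norm1_def)
  show "w $ 1 * w $ 2 > 0" using s w by (auto simp: zero_less_mult_iff)
qed

lemma state_mat_expands:
  assumes "v $ 1 * v $ 2 > 0" "set cs \<subseteq> {..<3}" "0 \<notin> set (butlast cs)"
  shows "norm1 (state_mat cs *v (elem_mat 0 *v v)) \<ge> norm1 v
     + (if cs \<noteq> [] \<and> hd cs \<noteq> 0 then 1 else 0)"
  using assms
proof (induction cs arbitrary: v)
  case Nil then show ?case by (simp add: vec2_entries norm1_def)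
next
  case (Cons c cs)
  let ?w = "turns c *v (elem_mat 0 *v v)"
  have e: "state_mat (c # cs) *v (elem_mat 0 *v v) = state_mat cs *v (elem_mat 0 *v ?w)"
    by (simp add: matrix_vector_mul_assoc matrix_mul_assoc)
  show ?case
  proof (cases "c = 0")
    case True
    then have "cs = []" using Cons.prems(3) by (auto split: if_splits)
    then show ?thesis unfolding e using True by (simp add: vec2_entries norm1_def)
  next
    case False
    then have c: "c \<in> {1, 2}" using Cons.prems(2) by auto
    have "0 \<notin> set (butlast cs)" using Cons.prems(3) by (auto split: if_splits)
    then have "norm1 ?w \<le> norm1 (state_mat cs *v (elem_mat 0 *v ?w))"
      using Cons.IH[OF turns_expands(1)[OF Cons.prems(1) c]] Cons.prems(2) by (auto split: if_splits)
    then show ?thesis unfolding e using turns_expands(2)[OF Cons.prems(1) c] False by simp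
  qed
qed

lemma state_mat_trivial_iff:
  assumes "reduced s"
  shows "eq_sign (state_mat s) (mat 1) \<longleftrightarrow> s = [0]"
proof
  assume t: "eq_sign (state_mat s) (mat 1)"
  obtain c cs where s: "s = c # cs" using assms by (cases s) (auto simp: reduced_def)
  have cs: "set cs \<subseteq> {..<3}" "0 \<notin> set (butlast cs)" "c < 3" using assms by (auto simp: reduced_def s)
  have e: "state_mat s *v v = state_mat cs *v (elem_mat 0 *v (turns c *v v))" for v
    by (simp add: s matrix_vector_mul_assoc matrix_mul_assoc)
  \<comment> \<open>The test vector lies in the half expanded by the rightmost factor of the reduced word: \<open>(1, -1)\<close> for a power of \<open>U\<close>, \<open>(1, 1)\<close> for \<open>S\<close>.\<close>
  have "c = 0"
  proof (rule ccontr)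
    assume "c \<noteq> 0"
    then have c: "c = 1 \<or> c = 2" using cs(3) by auto
    define v where "v = turns c *v vector [1, -1]"
    have v: "v $ 1 * v $ 2 > 0" "norm1 v = 3"
      using c unfolding v_def by (auto simp: numeral_2_eq_2 vec2_entries matrix_matrix_mult_def norm1_def)
    have "norm1 (state_mat s *v vector [1, -1]) \<ge> 3"
      using state_mat_expands[OF v(1) cs(1,2)] v(2) unfolding e v_def by (auto split: if_splits)
    then show False unfolding norm1_eq_sign[OF t] by (simp add: norm1_def)
  qed
  moreover have "cs = []"
  proof (rule ccontr)
    assume ne: "cs \<noteq> []"
    show False
    proof (cases "hd cs = 0")
      case True
      then have "cs = [0]" using ne cs(2) by (cases cs) (auto split: if_splits)
      then show False using t unfolding s \<open>c = 0\<close> by (auto simp: eq_sign_def mat2_entries)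
    next
      case False
      have "norm1 (state_mat s *v vector [1, 1]) \<ge> 3"
        using state_mat_expands[OF _ cs(1,2), of "vector [1, 1]"] False ne unfolding e \<open>c = 0\<close>
        by (simp add: norm1_def)
      then show False unfolding norm1_eq_sign[OF t] by (simp add: norm1_def)
    qed
  qed
  ultimately show "s = [0]" by (simp add: s)
next
  assume "s = [0]"
  then show "eq_sign (state_mat s) (mat 1)" by (simp add: elem_mat_0_square eq_sign_def)
qed

unbundle no vec_syntax
unbundle fps_syntax

section \<open>The powers of the series P\<close>

text \<open>With an integer lower entry, Pascal's rule holds without side conditions.\<close>
definition int_binomial :: "nat \<Rightarrow> int \<Rightarrow> rat" where
  "int_binomial n k = (if k < 0 then 0 else of_nat (n choose nat k))"

lemma int_binomial_neg [simp]: "k < 0 \<Longrightarrow> int_binomial n k = 0"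
  by (simp add: int_binomial_def)

lemma int_binomial_of_nat [simp]: "int_binomial n (int k) = of_nat (n choose k)"
  by (simp add: int_binomial_def)

lemma int_binomial_Suc: "int_binomial (Suc n) k = int_binomial n k + int_binomial n (k - 1)"
proof (cases "k > 0")
  case True
  then obtain j where "k = int (Suc j)" by (metis gr0_implies_Suc zero_less_imp_eq_int)
  then show ?thesis by (simp add: int_binomial_def nat_add_distrib)
next
  case False
  then show ?thesis by (cases "k = 0") (auto simp: int_binomial_def)
qed

text \<open>For \<open>N \<ge> 1\<close> and \<open>\<phi> = (1 + y)\<^sup>2 (1 + s y)\<close>, \<open>coeff_term r N i\<close> is the coefficient of
  \<open>y^N s^i\<close> in \<open>(1 + y)^r \<phi>^(N - 1) (\<phi> - y \<phi>')\<close>. This is the Lagrange form of the coefficient of \<open>t^N s^i\<close> in the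
  \<open>r\<close>-th power of the solution of \<open>p = 1 + t p\<^sup>2 (1 + s (p - 1))\<close>; for \<open>t = X\<close> and \<open>s = X\<^sup>2\<close> this
  equation is that of \<open>P\<close>. In this form, unlike in the closed one, the recurrence in \<open>r\<close> is
  Pascal's rule.\<close>
fun coeff_term :: "nat \<Rightarrow> nat \<Rightarrow> int \<Rightarrow> rat" where
  "coeff_term r 0 i = (if i = 0 then 1 else 0)"
| "coeff_term r (Suc N) i =
     int_binomial N i * (int_binomial (2 * N + 1 + r) (int N + 1 - i) - int_binomial (2 * N + 1 + r) (int N - i))
     - 2 * int_binomial N (i - 1) * int_binomial (2 * N + 1 + r) (int N - i)"

lemma coeff_term_neg: "i < 0 \<Longrightarrow> coeff_term r N i = 0"
  by (cases N) auto

text \<open>The coefficients of \<open>p^(r+1) = p^r + t p^(r+2) + t s (p^(r+3) - p^(r+2))\<close>.\<close>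
lemma coeff_term_rec:
  "coeff_term (Suc r) (Suc N) i = coeff_term r (Suc N) i + coeff_term (r + 2) N i
     + (coeff_term (r + 3) N (i - 1) - coeff_term (r + 2) N (i - 1))"
proof (cases N)
  case 0
  consider "i < 0" | "i = 0" | "i = 1" | "i > 1" by linarith
  then show ?thesis
    by cases (simp add: 0 int_binomial_def, simp_all add: 0 int_binomial_def)
next
  case (Suc K)
  define m where "m = 2 * K + 3 + r"
  have e: "2 * K + 1 + (r + 2) = m" "2 * K + 1 + (r + 3) = Suc m"
       "2 * Suc K + 1 + Suc r = Suc m" "2 * Suc K + 1 + r = m"
    by (simp_all add: m_def)
  have i: "int (Suc K) + 1 - i - 1 = int (Suc K) - i" "int (Suc K) - i - 1 = int K - i"
    "int K + 1 - (i - 1) = int (Suc K) + 1 - i" "int K - (i - 1) = int (Suc K) - i"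
    "int K + 1 - i = int (Suc K) - i" "int (Suc K) + 1 - i - 1 - 1 = int K - i"
    by auto
  show ?thesis
    unfolding Suc coeff_term.simps e int_binomial_Suc[of m] int_binomial_Suc[of K] i
    by (simp add: algebra_simps)
qed

lemma binomial_step: "(n - k) * (n choose k) = Suc k * (n choose Suc k)"
  by (simp only: binomial_absorb_comp binomial_absorption)

lemma coeff_term_closed:
  "coeff_term r (Suc N) (int k) =
     of_nat r / of_nat (Suc N + r + k) * of_nat (N choose k) * int_binomial (2 * N + 1 + r) (int N + 1 - int k)"
proof (cases "k \<le> N")
  case False
  then show ?thesis by (simp add: int_binomial_def binomial_eq_0)
next
  case True
  define m where "m = 2 * N + 1 + r"
  define j where "j = N - k"
  have N: "N = k + j" using True by (simp add: j_def)
  \<comment> \<open>The neighbouring binomial coefficients, expressed through those of the claim.\<close>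
  have a: "of_nat (Suc N + r + k) * (of_nat (m choose j) :: rat) = of_nat (Suc j) * of_nat (m choose Suc j)"
  proof -
    have "(m - j) * (m choose j) = Suc j * (m choose Suc j)"
      by (rule binomial_step)
    moreover have "m - j = Suc N + r + k" by (simp add: m_def N)
    ultimately show ?thesis by (metis of_nat_mult)
  qed
  have b: "of_nat (Suc j) * int_binomial N (int k - 1) = (of_nat k * of_nat (N choose k) :: rat)"
  proof (cases k)
    case 0 then show ?thesis by simp
  next
    case (Suc l)
    have "Suc j * (N choose l) = Suc l * (N choose Suc l)"
      using binomial_step[of N l] by (simp add: N Suc Suc_diff_le)
    then have "of_nat (Suc j) * (of_nat (N choose l) :: rat) = of_nat (Suc l) * of_nat (N choose Suc l)"
      by (simp only: flip: of_nat_mult)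
    moreover have "int_binomial N (int k - 1) = of_nat (N choose l)" by (simp add: Suc)
    ultimately show ?thesis by (simp only: Suc)
  qed
  let ?d = "of_nat (Suc N + r + k) :: rat" and ?s = "of_nat (Suc j) :: rat"
  let ?C = "of_nat (m choose Suc j) :: rat" and ?A = "of_nat (N choose k) :: rat"
  have i: "int N + 1 - int k = int (Suc j)" "int N - int k = int j"
    using N by auto
  have "coeff_term r (Suc N) (int k) = ?A * (?C - of_nat (m choose j)) - 2 * int_binomial N (int k - 1) * of_nat (m choose j)"
    by (simp only: coeff_term.simps i m_def[symmetric] int_binomial_of_nat)
  also have "?d * \<dots> = ?A * (?d * ?C - ?d * of_nat (m choose j)) - 2 * int_binomial N (int k - 1) * (?d * of_nat (m choose j))"
    by (simp add: algebra_simps)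
  also have "\<dots> = ?A * (?d - ?s) * ?C - 2 * (?s * int_binomial N (int k - 1)) * ?C"
    unfolding a by (simp add: algebra_simps)
  also have "\<dots> = ?A * (?d - ?s - 2 * of_nat k) * ?C"
    unfolding b by (simp add: algebra_simps)
  also have "?d - ?s - 2 * of_nat k = of_nat r" by (simp add: N)
  finally have "?d * coeff_term r (Suc N) (int k) = of_nat r * ?A * ?C" by simp
  moreover have "?d \<noteq> 0" by (simp del: of_nat_Suc of_nat_add)
  ultimately show ?thesis
    unfolding i m_def[symmetric] int_binomial_of_nat by (simp add: field_simps del: of_nat_Suc of_nat_add)
qed

definition lagrange_power :: "nat \<Rightarrow> rat fps" where
  "lagrange_power r = Abs_fps (\<lambda>m. \<Sum>k = 0..m div 2. coeff_term r (m - 2 * k) (int k))"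

lemma lagrange_power_nth_terms: "lagrange_power r $ m = (\<Sum>k = 0..m div 2. coeff_term r (m - 2 * k) (int k))"
  by (simp add: lagrange_power_def)

lemma lagrange_power_0: "lagrange_power 0 = 1"
proof (rule fps_ext)
  fix m
  have "(\<Sum>k = 0..m div 2. coeff_term 0 (m - 2 * k) (int k)) = (\<Sum>k = 0..m div 2. if k = 0 \<and> m = 0 then 1 else 0)"
  proof (rule sum.cong[OF refl])
    fix k assume "k \<in> {0..m div 2}"
    then show "coeff_term 0 (m - 2 * k) (int k) = (if k = 0 \<and> m = 0 then 1 else 0)"
      by (cases "m - 2 * k") (auto simp: coeff_term_closed simp del: coeff_term.simps(2))
  qed
  then show "lagrange_power 0 $ m = 1 $ m" by (auto simp: lagrange_power_def)
qed

lemma lagrange_power_rec: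
  "lagrange_power (Suc r) = lagrange_power r + fps_X * (lagrange_power (r + 2) + fps_X ^ 2 * (lagrange_power (r + 3) - lagrange_power (r + 2)))"
proof (rule fps_ext)
  fix n
  show "lagrange_power (Suc r) $ n = (lagrange_power r + fps_X * (lagrange_power (r + 2) + fps_X ^ 2 * (lagrange_power (r + 3) - lagrange_power (r + 2)))) $ n"
  proof (cases n)
    case 0 then show ?thesis by (simp add: lagrange_power_def)
  next
    case (Suc m)
    \<comment> \<open>Terms with \<open>Suc m - 2 * k = 0\<close> vanish here, so the range can be cut to indices where the recurrence applies.\<close>
    have drop: "lagrange_power s $ Suc m = (\<Sum>k = 0..m div 2. coeff_term s (Suc (m - 2 * k)) (int k))" for s
    proof -
      have "(\<Sum>k = 0..m div 2. coeff_term s (Suc m - 2 * k) (int k)) = (\<Sum>k = 0..Suc m div 2. coeff_term s (Suc m - 2 * k) (int k))"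
      proof (rule sum.mono_neutral_left)
        show "\<forall>k\<in>{0..Suc m div 2} - {0..m div 2}. coeff_term s (Suc m - 2 * k) (int k) = 0"
        proof
          fix k assume "k \<in> {0..Suc m div 2} - {0..m div 2}"
          then have "Suc m - 2 * k = 0" "k \<noteq> 0" by auto
          then show "coeff_term s (Suc m - 2 * k) (int k) = 0" by simp
        qed
      qed auto
      moreover have "(\<Sum>k = 0..m div 2. coeff_term s (Suc m - 2 * k) (int k)) = (\<Sum>k = 0..m div 2. coeff_term s (Suc (m - 2 * k)) (int k))"
        by (intro sum.cong refl) (simp add: Suc_diff_le)
      ultimately show ?thesis by (simp add: lagrange_power_def)
    qed
    have shift: "(\<Sum>k = 0..m div 2. coeff_term s (m - 2 * k) (int k - 1)) = (fps_X ^ 2 * lagrange_power s) $ m" for s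
    proof (cases "m < 2")
      case True
      then have "m div 2 = 0" by simp
      then show ?thesis using True by (simp add: fps_X_power_mult_nth coeff_term_neg)
    next
      case False
      then obtain l where l: "m = l + 2" by (metis add.commute le_Suc_ex not_less)
      have "(\<Sum>k = 0..m div 2. coeff_term s (m - 2 * k) (int k - 1)) = (\<Sum>k = Suc 0..Suc (l div 2). coeff_term s (m - 2 * k) (int k - 1))"
        using l by (simp add: sum.atLeast_Suc_atMost coeff_term_neg)
      also have "\<dots> = (\<Sum>k = 0..l div 2. coeff_term s (l - 2 * k) (int k))"
        unfolding sum.shift_bounds_cl_Suc_ivl l by simp
      finally show ?thesis using l by (simp add: fps_X_power_mult_nth lagrange_power_def)
    qed
    show ?thesis
      unfolding Suc fps_add_nth fps_X_mult_nth drop coeff_term_rec[of r] right_diff_distrib fps_sub_nth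
      by (simp add: sum.distrib sum_subtractf shift del: add_2_eq_Suc add_2_eq_Suc' One_nat_def)
        (simp add: lagrange_power_nth_terms)
  qed
qed

text \<open>The coefficient of \<open>X^m\<close> in \<open>f (Suc r)\<close> is that in \<open>f r\<close> plus a combination of coefficients of
  lower order, so that it vanishes by induction on \<open>m\<close> and, for fixed \<open>m\<close>, on \<open>r\<close>.\<close>
lemma linear_system_zero:
  fixes f :: "nat \<Rightarrow> rat fps"
  assumes "f 0 = 0"
    and rec: "\<And>r. f (Suc r) = f r + fps_X * (f (r + 2) + fps_X ^ 2 * (f (r + 3) - f (r + 2)))"
  shows "f r = 0"
proof -
  have "f r $ m = 0" for r m
  proof (induction m arbitrary: r rule: less_induct)
    case (less m)
    show ?case
    proof (induction r)
      case 0 show ?case by (simp add: assms(1))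
    next
      case (Suc r)
      have "(fps_X * (f (r + 2) + fps_X ^ 2 * (f (r + 3) - f (r + 2)))) $ m = 0"
        using less by (cases m) (auto simp: fps_X_power_mult_nth)
      then show ?case by (subst rec) (simp add: Suc.IH)
    qed
  qed
  then show ?thesis by (simp add: fps_eq_iff)
qed

text \<open>Both sides solve the same linear system in \<open>r\<close> with the value \<open>lagrange_power s\<close> at \<open>r = 0\<close>.\<close>
lemma lagrange_power_add: "lagrange_power (r + s) = lagrange_power r * lagrange_power s"
proof -
  have "lagrange_power (r + s) - lagrange_power r * lagrange_power s = 0"
  proof (rule linear_system_zero[of "\<lambda>r. lagrange_power (r + s) - lagrange_power r * lagrange_power s"])
    show "lagrange_power (0 + s) - lagrange_power 0 * lagrange_power s = 0" by (simp add: lagrange_power_0)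
    fix r
    have step: "lagrange_power (Suc r + s) = lagrange_power (r + s)
       + fps_X * (lagrange_power (r + 2 + s) + fps_X ^ 2 * (lagrange_power (r + 3 + s) - lagrange_power (r + 2 + s)))"
      using lagrange_power_rec[of "r + s"] by (simp add: ac_simps)
    show "lagrange_power (Suc r + s) - lagrange_power (Suc r) * lagrange_power s = lagrange_power (r + s) - lagrange_power r * lagrange_power s +
       fps_X * (lagrange_power (r + 2 + s) - lagrange_power (r + 2) * lagrange_power s + fps_X\<^sup>2 * (lagrange_power (r + 3 + s) - lagrange_power (r + 3) * lagrange_power s
          - (lagrange_power (r + 2 + s) - lagrange_power (r + 2) * lagrange_power s)))"
      unfolding step lagrange_power_rec[of r] by (simp only: algebra_simps)
  qed
  then show ?thesis by simp
qed

lemma binom_of_nat: "binom (int n) (int k) = n choose k"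
  by (simp add: binom_def)

text \<open>The index \<open>k\<close> may exceed \<open>m div 3\<close> only where the binomial coefficients vanish. For \<open>m = 0\<close> the
  upper entry is negative, and the value \<open>1\<close> of \<open>binom\<close> is the right one.\<close>
lemma lagrange_power_nth:
  assumes "r \<ge> 1"
  shows "lagrange_power r $ m = (\<Sum>k = 0..m div 3. of_int (int r) / of_int (int m + int r - int k)
          * of_nat (binom (int m - 2 * int k - 1) (int k))
          * of_nat (binom (2 * int m - 4 * int k + int r - 1) (int m - 3 * int k)))"
    (is "_ = (\<Sum>k = 0.._. ?t k)")
proof (cases m)
  case 0 then show ?thesis using assms by (simp add: lagrange_power_def binom_def)
next
  case (Suc n)
  have z: "coeff_term r (m - 2 * k) (int k) = 0" if "k \<in> {0..m div 2} - {0..m div 3}" for k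
    using that Suc by (cases "m - 2 * k") (auto simp: coeff_term_closed simp del: coeff_term.simps(2))
  have "lagrange_power r $ m = (\<Sum>k = 0..m div 3. coeff_term r (m - 2 * k) (int k))"
    unfolding lagrange_power_def fps_nth_Abs_fps
    by (rule sum.mono_neutral_right) (use z in auto)
  also have "\<dots> = sum ?t {0..m div 3}"
  proof (rule sum.cong[OF refl])
    fix k assume "k \<in> {0..m div 3}"
    then have k: "3 * k \<le> m" by auto
    then obtain N where N: "m - 2 * k = Suc N" using Suc by (cases "m - 2 * k") auto
    then have m: "m = Suc N + 2 * k" by simp
    have kN: "k \<le> Suc N" using k m by simp
    have "coeff_term r (m - 2 * k) (int k) = of_nat r / of_nat (Suc N + r + k) * of_nat (N choose k)
       * int_binomial (2 * N + 1 + r) (int N + 1 - int k)"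
      unfolding N coeff_term_closed ..
    moreover have "(of_nat (Suc N + r + k) :: rat) = of_int (int m + int r - int k)"
      by (simp add: m)
    moreover have "binom (int m - 2 * int k - 1) (int k) = N choose k"
      by (simp add: binom_def m)
    moreover have "int_binomial (2 * N + 1 + r) (int N + 1 - int k) = of_nat (binom (2 * int m - 4 * int k + int r - 1) (int m - 3 * int k))"
    proof -
      have e: "2 * int m - 4 * int k + int r - 1 = int (2 * N + 1 + r)"
          "int m - 3 * int k = int (Suc N - k)" "int N + 1 - int k = int (Suc N - k)"
        using kN by (simp_all add: m of_nat_diff)
      show ?thesis unfolding e by (simp only: int_binomial_of_nat binom_of_nat)
    qed
    ultimately show "coeff_term r (m - 2 * k) (int k) = ?t k" by simp
  qed
  finally show ?thesis .
qed

lemma P_eq_lagrange_power: "P = lagrange_power 1"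
proof (rule fps_ext)
  fix m show "P $ m = lagrange_power 1 $ m"
    by (subst lagrange_power_nth) (auto simp: P_def P_coeff_def binom_def algebra_simps)
qed

lemma P_power: "P ^ r = lagrange_power r"
  by (induction r) (simp_all add: lagrange_power_0 P_eq_lagrange_power flip: lagrange_power_add)

lemma P_equation: "(P - 1) * (1 - fps_X ^ 3 * P ^ 2) = fps_X * P ^ 2"
proof -
  have "P ^ 1 = P ^ 0 + fps_X * (P ^ 2 + fps_X ^ 2 * (P ^ 3 - P ^ 2))"
    unfolding P_power using lagrange_power_rec[of 0] by (simp add: numeral_2_eq_2 numeral_3_eq_3)
  then show ?thesis by (simp add: algebra_simps power2_eq_square power3_eq_cube)
qed

section \<open>Generating functions of walks to the identity\<close>

definition inner_turns :: "rat fps" where "inner_turns = inverse (1 - fps_X ^ 3 * P ^ 2)"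
definition bottom_turns :: "rat fps" where "bottom_turns = inverse (1 - fps_X ^ 3 * P ^ 3)"

lemma inner_turns_unfold: "inner_turns = 1 + fps_X ^ 3 * P ^ 2 * inner_turns"
proof -
  have "inner_turns * (1 - fps_X ^ 3 * P ^ 2) = 1"
    unfolding inner_turns_def by (rule inverse_mult_eq_1) simp
  then show ?thesis by (simp add: algebra_simps)
qed

lemma bottom_turns_unfold: "bottom_turns = 1 + fps_X ^ 3 * P ^ 3 * bottom_turns"
proof -
  have "bottom_turns * (1 - fps_X ^ 3 * P ^ 3) = 1"
    unfolding bottom_turns_def by (rule inverse_mult_eq_1) simp
  then show ?thesis by (simp add: algebra_simps)
qed

lemma P_minus_1: "P - 1 = fps_X * P ^ 2 * inner_turns"
proof -
  have "P - 1 = (P - 1) * ((1 - fps_X ^ 3 * P ^ 2) * inner_turns)"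
    unfolding inner_turns_def by (subst inverse_mult_eq_1') simp_all
  then show ?thesis unfolding mult.assoc[symmetric] P_equation .
qed

lemma one_minus_inverse_P: "1 - inverse P = fps_X * P * inner_turns"
proof -
  have "1 - inverse P = (P - 1) * inverse P"
    by (simp add: algebra_simps P_mult_inverse)
  also have "\<dots> = fps_X * P * inner_turns * (P * inverse P)"
    unfolding P_minus_1 by (simp add: power2_eq_square algebra_simps)
  finally show ?thesis by (simp add: P_mult_inverse)
qed

text \<open>The weight of all ways to reach the exit of a triangle from position \<open>c\<close> and to cross it, with
  excursions allowed at every corner on the way except the exit.\<close>
definition exit_ser :: "nat \<Rightarrow> rat fps" where
  "exit_ser c = (if c = 0 then fps_X ^ 2 * P ^ 2 * inner_turns else if c = 1 then fps_X * P * inner_turns else inner_turns)"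

text \<open>In the bottom triangle there is no exit: the weight of all ways to arrive at position \<open>0\<close> by at
  least one turn and stop there, with excursions allowed at position \<open>0\<close> too.\<close>
definition close_ser :: "nat \<Rightarrow> rat fps" where
  "close_ser c = (if c = 0 then fps_X ^ 3 * P ^ 2 * bottom_turns else if c = 1 then fps_X ^ 2 * P * bottom_turns else fps_X * bottom_turns)"

fun weight :: "nat list \<Rightarrow> rat fps" where
  "weight [] = 1"
| "weight [c] = close_ser c"
| "weight (c # d # s) = exit_ser c * weight (d # s)"

text \<open>The summand \<open>1\<close> is the empty tuple, which is a walk only for the stack of the identity. A walk
  that comes back to position \<open>0\<close> of the bottom triangle from an excursion ends with \<open>S\<close> and must
  continue, which is why the correction is not part of \<open>close_ser\<close>.\<close>
definition walk_series :: "nat list \<Rightarrow> rat fps" where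
  "walk_series s = weight s + (if s = [0] then 1 else 0)"

lemma weight_Cons: "s \<noteq> [] \<Longrightarrow> weight (c # s) = exit_ser c * weight s"
  by (cases s) auto

lemma weight_replicate: "s \<noteq> [] \<Longrightarrow> weight (replicate j c @ s) = exit_ser c ^ j * weight s"
  by (induction j) (simp_all add: weight_Cons mult.assoc)

lemma weight_nth_0: "s \<noteq> [] \<Longrightarrow> weight s $ 0 = 0"
  by (induction s rule: weight.induct) (auto simp: close_ser_def)

lemma exit_ser_1: "exit_ser 1 = 1 - inverse P"
  by (simp add: exit_ser_def one_minus_inverse_P)

text \<open>The factor \<open>X\<close> is that of the turn, \<open>P\<close> that of the optional excursion after it. At the identity
  the walk may also stop, but then without a preceding excursion.\<close>
lemma weight_turn:
  assumes "c < 3" "c = 2 \<longrightarrow> cs = []"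
  shows "weight (c # cs) = fps_X * (P * weight (turn c # cs) + (if turn c # cs = [0] then 1 else 0))"
proof (cases "cs = []")
  case True
  have "close_ser 2 = fps_X * (P * close_ser 0 + 1)"
    using arg_cong[OF bottom_turns_unfold, of "(*) fps_X"]
    by (simp add: close_ser_def algebra_simps power_numeral_reduce)
  moreover have "c = 0 \<or> c = 1 \<or> c = 2" using assms(1) by auto
  ultimately show ?thesis
    using True by (auto simp: turn_def close_ser_def algebra_simps power_numeral_reduce)
next
  case False
  then have "c = 0 \<or> c = 1" using assms by auto
  then show ?thesis
    using False by (auto simp: weight_Cons turn_def exit_ser_def algebra_simps power_numeral_reduce)
qed

text \<open>After the last turn in a triangle the walk either goes round again, or leaves it and resumes in
  the enclosing triangle. Leaving ends no component, so it costs no \<open>X\<close>.\<close>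
lemma weight_pop: "s \<noteq> [] \<Longrightarrow> weight (2 # s) = fps_X * weight (0 # s) + weight s"
  using arg_cong[OF inner_turns_unfold, of "\<lambda>x. x * weight s"]
  by (simp add: weight_Cons exit_ser_def algebra_simps power_numeral_reduce)

lemma exit_ser_1_power_nth:
  assumes "n < j"
  shows "(exit_ser 1 ^ j * H) $ n = 0"
proof -
  have "exit_ser 1 ^ j * H = fps_X ^ j * ((P * inner_turns) ^ j * H)"
    by (simp add: exit_ser_def power_mult_distrib mult_ac)
  then show ?thesis using assms by (simp only: fps_X_power_mult_nth if_True)
qed

lemma geometric_sum_split: "(1 - x) * (\<Sum>j\<le>n. x ^ j) + x ^ Suc n = 1" for x :: "'a :: comm_ring_1"
  by (simp only: lessThan_Suc_atMost[symmetric] one_diff_power_eq[symmetric]) simp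

text \<open>The series \<open>exit_ser 1\<close> is divisible by \<open>X\<close>, hence the coefficients up to \<open>n\<close> of the geometric
  series \<open>P = 1 / (1 - exit_ser 1)\<close> come from its first \<open>n + 1\<close> terms.\<close>
lemma sum_exit_ser_1_powers: "(\<Sum>j\<le>n. (exit_ser 1 ^ j * H) $ n) = (P * H) $ n"
proof -
  have "P * H = P * ((1 - exit_ser 1) * (\<Sum>j\<le>n. exit_ser 1 ^ j) + exit_ser 1 ^ Suc n) * H"
    by (simp only: geometric_sum_split mult_1_right)
  also have "\<dots> = (P * inverse P) * (\<Sum>j\<le>n. exit_ser 1 ^ j) * H + exit_ser 1 ^ Suc n * (P * H)"
    unfolding exit_ser_1 by (simp only: algebra_simps)
  also have "\<dots> = (\<Sum>j\<le>n. exit_ser 1 ^ j * H) + exit_ser 1 ^ Suc n * (P * H)"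
    by (simp add: P_mult_inverse sum_distrib_right)
  finally have "P * H = (\<Sum>j\<le>n. exit_ser 1 ^ j * H) + exit_ser 1 ^ Suc n * (P * H)" .
  from arg_cong[OF this, of "\<lambda>F. F $ n"]
  have "(P * H) $ n = (\<Sum>j\<le>n. (exit_ser 1 ^ j * H) $ n) + (exit_ser 1 ^ Suc n * (P * H)) $ n"
    by (simp only: fps_add_nth fps_sum_nth)
  then show ?thesis by (simp only: exit_ser_1_power_nth[OF lessI] add_0_right)
qed

lemma walks_union:
  "walks (state_mat (c # cs)) (Suc n)
     = (\<Union>j. (#) (int (Suc j)) ` walks (state_mat (replicate j 1 @ turn c # cs)) n)"
proof (intro set_eqI iffI)
  fix as assume "as \<in> walks (state_mat (c # cs)) (Suc n)"
  then obtain a bs where a: "as = a # bs" "a > 0" "bs \<in> walks (state_mat (c # cs) ** elem_mat a) n"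
    by (auto simp: in_walks_Suc)
  from a(2) obtain j where "a = int (Suc j)" by (metis gr0_implies_Suc zero_less_imp_eq_int)
  with a walks_cong[OF state_mat_descend[of c cs j]]
  show "as \<in> (\<Union>j. (#) (int (Suc j)) ` walks (state_mat (replicate j 1 @ turn c # cs)) n)" by auto
next
  fix as assume "as \<in> (\<Union>j. (#) (int (Suc j)) ` walks (state_mat (replicate j 1 @ turn c # cs)) n)"
  then show "as \<in> walks (state_mat (c # cs)) (Suc n)"
    using walks_cong[OF state_mat_descend[of c cs]] by (auto simp: Cons_in_walks)
qed

lemma walks_pop:
  "walks (state_mat (2 # s)) (Suc n) = (#) 1 ` walks (state_mat (0 # s)) n
     \<union> (\<lambda>as. (hd as + 1) # tl as) ` walks (state_mat s) (Suc n)"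
proof (intro set_eqI iffI)
  fix as assume "as \<in> walks (state_mat (2 # s)) (Suc n)"
  then obtain a bs where a: "as = a # bs" "a > 0" "bs \<in> walks (state_mat (2 # s) ** elem_mat a) n"
    by (auto simp: in_walks_Suc)
  show "as \<in> (#) 1 ` walks (state_mat (0 # s)) n \<union> (\<lambda>as. (hd as + 1) # tl as) ` walks (state_mat s) (Suc n)"
  proof (cases "a = 1")
    case True
    then show ?thesis using a walks_cong[OF state_mat_turn[of 2 s]] by (simp add: turn_def)
  next
    case False
    have "bs \<in> walks (state_mat s ** elem_mat (a - 1)) n"
      using a(3) walks_cong[OF state_mat_pop[of s "a - 1"]] by simp
    then have "(a - 1) # bs \<in> walks (state_mat s) (Suc n)"
      using False a(2) by (simp add: Cons_in_walks)
    then show ?thesis using a(1) by (force simp: image_iff)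
  qed
next
  fix as assume "as \<in> (#) 1 ` walks (state_mat (0 # s)) n \<union> (\<lambda>as. (hd as + 1) # tl as) ` walks (state_mat s) (Suc n)"
  then show "as \<in> walks (state_mat (2 # s)) (Suc n)"
  proof
    assume "as \<in> (#) 1 ` walks (state_mat (0 # s)) n"
    then show ?thesis using walks_cong[OF state_mat_turn[of 2 s]] by (auto simp: Cons_in_walks turn_def)
  next
    assume "as \<in> (\<lambda>as. (hd as + 1) # tl as) ` walks (state_mat s) (Suc n)"
    then show ?thesis using walks_cong[OF state_mat_pop[of s]]
      by (auto simp: in_walks_Suc)
  qed
qed

lemma reduced_descend:
  assumes "reduced (c # cs)" "c = 2 \<longrightarrow> cs = []"
  shows "reduced (replicate j 1 @ turn c # cs)"
proof -
  have "turn c < 3" "cs \<noteq> [] \<longrightarrow> turn c \<noteq> 0" using assms by (auto simp: reduced_def turn_def)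
  then show ?thesis using assms by (cases j) (auto simp: reduced_def butlast_append)
qed

text \<open>By induction on \<open>n\<close>, splitting off the head of the tuple. The head of value \<open>j + 1\<close> leads to a
  stack with \<open>j\<close> additional entries; infinitely many heads are possible, but by the induction
  hypothesis a stack of more than \<open>n\<close> additional entries cannot be emptied by \<open>n\<close> components. At
  the last corner of a triangle that is not the bottom one, the induction is on the stack instead:
  a head greater than \<open>1\<close> leaves the triangle, and the length of the tuple does not decrease.\<close>
theorem card_walks:
  assumes "reduced s"
  shows "finite (walks (state_mat s) n) \<and> of_nat (card (walks (state_mat s) n)) = walk_series s $ n"
  using assms
proof (induction n arbitrary: s)
  case 0
  then show ?case
    using weight_nth_0[of s] by (auto simp: walks_0 state_mat_trivial_iff walk_series_def reduced_def)
next
  case (Suc n)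
  show ?case using Suc.prems
  proof (induction s)
    case Nil then show ?case by (simp add: reduced_def)
  next
    case (Cons c cs)
    have c: "c < 3" using Cons.prems by (simp add: reduced_def)
    show ?case
    proof (cases "c = 2 \<and> cs \<noteq> []")
      case True
      then have v: "reduced (0 # cs)" "reduced cs"
        using Cons.prems by (cases cs; auto simp: reduced_def split: if_splits dest: in_set_butlastD)+
      let ?A = "walks (state_mat (0 # cs)) n" and ?B = "walks (state_mat cs) (Suc n)"
      let ?inc = "\<lambda>as. (hd as + 1) # tl as :: int list"
      have A: "finite ?A" "of_nat (card ?A) = walk_series (0 # cs) $ n" using Suc.IH[OF v(1)] by auto
      have B: "finite ?B" "of_nat (card ?B) = walk_series cs $ Suc n" using Cons.IH[OF v(2)] by auto
      have inj: "inj_on ?inc ?B" by (auto simp: inj_on_def in_walks_Suc)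
      have dj: "(#) 1 ` ?A \<inter> ?inc ` ?B = {}" by (auto simp: in_walks_Suc)
      have e: "walks (state_mat (c # cs)) (Suc n) = (#) 1 ` ?A \<union> ?inc ` ?B"
        using True walks_pop by simp
      have "card (walks (state_mat (c # cs)) (Suc n)) = card ?A + card ?B"
        unfolding e using A(1) B(1) dj inj by (simp add: card_Un_disjoint card_image)
      moreover have "walk_series (c # cs) $ Suc n = walk_series (0 # cs) $ n + walk_series cs $ Suc n"
        using True weight_pop[of cs] by (auto simp: walk_series_def)
      ultimately show ?thesis using A B e by simp
    next
      case False
      let ?s = "\<lambda>j. replicate j 1 @ turn c # cs"
      let ?S = "\<lambda>j. walks (state_mat (?s j)) n"
      have IH: "finite (?S j)" "of_nat (card (?S j)) = walk_series (?s j) $ n" for j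
        using Suc.IH[OF reduced_descend[OF Cons.prems]] False by auto
      have w: "walk_series (?s j) = exit_ser 1 ^ j * weight (turn c # cs) + (if j = 0 \<and> turn c # cs = [0] then 1 else 0)" for j
        unfolding walk_series_def by (cases j) (simp_all add: weight_replicate del: replicate_Suc, simp)
      have empty: "?S j = {}" if "j > n" for j
        using IH[of j] exit_ser_1_power_nth[OF that] that unfolding w by simp
      have e: "walks (state_mat (c # cs)) (Suc n) = (\<Union>j\<in>{..n}. (#) (int (Suc j)) ` ?S j)"
        unfolding walks_union using empty by (fastforce simp: not_le[symmetric])
      have "card (\<Union>j\<in>{..n}. (#) (int (Suc j)) ` ?S j) = (\<Sum>j\<le>n. card ((#) (int (Suc j)) ` ?S j))"
        by (rule card_UN_disjoint) (use IH(1) in auto)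
      then have "of_nat (card (walks (state_mat (c # cs)) (Suc n))) = (\<Sum>j\<le>n. walk_series (?s j) $ n)"
        unfolding e by (simp only: of_nat_sum card_image inj_on_Cons1 IH(2))
      also have "\<dots> = (P * weight (turn c # cs)) $ n + (if turn c # cs = [0] then 1 else 0) $ n"
      proof -
        have "(\<Sum>j\<le>n. ((if j = 0 \<and> turn c # cs = [0] then 1 else 0) :: rat fps) $ n)
            = (\<Sum>j\<le>n. if j = 0 then (if turn c # cs = [0] then 1 else 0) $ n else 0)"
          by (intro sum.cong) auto
        then show ?thesis unfolding w fps_add_nth sum.distrib sum_exit_ser_1_powers by simp
      qed
      also have "\<dots> = walk_series (c # cs) $ Suc n"
        using weight_turn[OF c, of cs] False by (auto simp: walk_series_def)
      finally show ?thesis using IH(1) unfolding e by auto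
    qed
  qed
qed

section \<open>Quiddities\<close>

lemma quiddity_rev: "quiddity (rev as) \<and> length as = Suc n \<longleftrightarrow> as \<in> walks (mat 1) (Suc n)"
  by (auto simp: quiddity_def walks_def eq_sign_def)

lemma Q_coeff_Suc: "of_nat (Q_coeff (Suc n)) = weight [0] $ (n + 3)"
proof -
  have v: "reduced [0]" by (simp add: reduced_def)
  have p: "walks (mat 1) m = walks (state_mat [0]) m" for m
    by (rule walks_cong) (use state_mat_trivial_iff[OF v] in \<open>auto intro: eq_sign_sym\<close>)
  have "{as. quiddity as \<and> length as = Suc n + 2} = rev ` walks (state_mat [0]) (n + 3)"
  proof (intro set_eqI iffI)
    fix as assume "as \<in> {as. quiddity as \<and> length as = Suc n + 2}"
    then have "rev as \<in> walks (state_mat [0]) (n + 3)"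
      using quiddity_rev[of "rev as" "n + 2"] by (simp add: p numeral_3_eq_3)
    then show "as \<in> rev ` walks (state_mat [0]) (n + 3)" by (metis image_eqI rev_rev_ident)
  next
    fix as assume "as \<in> rev ` walks (state_mat [0]) (n + 3)"
    then show "as \<in> {as. quiddity as \<and> length as = Suc n + 2}"
      using quiddity_rev[of "rev as" "n + 2"] by (auto simp: p numeral_3_eq_3)
  qed
  then have "Q_coeff (Suc n) = card (walks (state_mat [0]) (n + 3))"
    by (simp add: Q_coeff_def card_image)
  then show ?thesis using card_walks[OF v, of "n + 3"] by (simp add: walk_series_def)
qed

text \<open>After its first component \<open>Suc j\<close>, the walk from the identity has reached the stack of \<open>j + 1\<close>
  entries \<open>1\<close>.\<close>
lemma V_coeff_Suc: "of_nat (V_coeff (Suc j) (Suc n)) = weight (replicate j 1 @ [1]) $ (n + 2)"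
proof -
  let ?k = "int (Suc j)" and ?s = "replicate j 1 @ [1 :: nat]"
  have v0: "reduced [0]" and v: "reduced ?s" 
    using reduced_descend[of 0 "[]" j] by (simp_all add: reduced_def turn_def)
  have "eq_sign (state_mat [0] ** elem_mat ?k) (state_mat ?s)"
    using state_mat_descend[of 0 "[]" j] by (simp add: turn_def)
  moreover have "eq_sign (mat 1 ** elem_mat ?k) (state_mat [0] ** elem_mat ?k)"
    using state_mat_trivial_iff[OF v0] by (intro eq_sign_mult_right) (auto intro: eq_sign_sym)
  ultimately have p: "walks (mat 1 ** elem_mat ?k) m = walks (state_mat ?s) m" for m
    by (intro walks_cong) (rule eq_sign_trans)
  have "{as. quiddity as \<and> length as = Suc n + 2 \<and> last as = ?k} = (\<lambda>bs. rev (?k # bs)) ` walks (state_mat ?s) (n + 2)"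
  proof (intro set_eqI iffI)
    fix as assume "as \<in> {as. quiddity as \<and> length as = Suc n + 2 \<and> last as = ?k}"
    then have as: "quiddity as" "length as = Suc (n + 2)" "last as = ?k" by auto
    then have "rev as \<in> walks (mat 1) (Suc (n + 2))" using quiddity_rev[of "rev as" "n + 2"] by simp
    moreover have "rev as = ?k # rev (butlast as)"
      using as(2,3) append_butlast_last_id[of as] by (metis length_0_conv nat.distinct(1) rev_eq_Cons_iff rev_rev_ident)
    ultimately have "rev (butlast as) \<in> walks (state_mat ?s) (n + 2)"
      using Cons_in_walks p by metis
    then show "as \<in> (\<lambda>bs. rev (?k # bs)) ` walks (state_mat ?s) (n + 2)"
      using \<open>rev as = ?k # rev (butlast as)\<close> by (metis image_eqI rev_rev_ident)
  next
    fix as assume "as \<in> (\<lambda>bs. rev (?k # bs)) ` walks (state_mat ?s) (n + 2)"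
    then obtain bs where bs: "as = rev (?k # bs)" "bs \<in> walks (state_mat ?s) (n + 2)" by auto
    then have "?k # bs \<in> walks (mat 1) (Suc (n + 2))" by (simp only: Cons_in_walks p) simp
    then show "as \<in> {as. quiddity as \<and> length as = Suc n + 2 \<and> last as = ?k}"
      using quiddity_rev[of "?k # bs" "n + 2"] bs(1) by simp
  qed
  then have "V_coeff (Suc j) (Suc n) = card (walks (state_mat ?s) (n + 2))"
    by (simp add: V_coeff_def card_image inj_on_def)
  then show ?thesis using card_walks[OF v, of "n + 2"] by (simp add: walk_series_def)
qed

lemma Q_minus_1: "Q - 1 = fps_X * P ^ 2 * bottom_turns"
proof (rule fps_ext)
  fix n
  show "(Q - 1) $ n = (fps_X * P ^ 2 * bottom_turns) $ n"
  proof (cases n)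
    case 0 then show ?thesis by (simp add: Q_def Q_coeff_def)
  next
    case (Suc m)
    have "weight [0] = fps_X ^ 2 * (fps_X * P ^ 2 * bottom_turns)"
      by (simp add: close_ser_def power_numeral_reduce mult_ac)
    then have "weight [0] $ (m + 3) = (fps_X * P ^ 2 * bottom_turns) $ Suc m"
      by (simp add: fps_X_power_mult_nth)
    then show ?thesis by (simp add: Suc Q_def Q_coeff_Suc)
  qed
qed

lemma V_Suc: "V (Suc j) = fps_X * P * bottom_turns * (1 - inverse P) ^ j"
proof (rule fps_ext)
  fix n
  show "V (Suc j) $ n = (fps_X * P * bottom_turns * (1 - inverse P) ^ j) $ n"
  proof (cases n)
    case 0 then show ?thesis by (simp add: V_def V_coeff_def)
  next
    case (Suc m)
    have "weight (replicate j 1 @ [1]) = fps_X * (fps_X * P * bottom_turns * (1 - inverse P) ^ j)"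
      by (simp add: weight_replicate close_ser_def exit_ser_1[simplified] power_numeral_reduce mult_ac)
    then have "weight (replicate j 1 @ [1]) $ (m + 2) = (fps_X * P * bottom_turns * (1 - inverse P) ^ j) $ Suc m"
      by simp
    then show ?thesis by (simp add: Suc V_def V_coeff_Suc)
  qed
qed

lemma Q_minus_1_over_P: "(Q - 1) * inverse P = fps_X * P * bottom_turns"
proof -
  have "(Q - 1) * inverse P = fps_X * P * bottom_turns * (P * inverse P)"
    unfolding Q_minus_1 by (simp add: power2_eq_square mult_ac)
  then show ?thesis by (simp add: P_mult_inverse)
qed

text \<open>The geometric series of \<open>X P / (1 - X\<^sup>3 P\<^sup>3)\<close>, whose \<open>j\<close>-th term starts at \<open>X^(3 j + 1)\<close>.\<close>
lemma geometric_P_nth: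
  "(fps_X * P * bottom_turns) $ Suc n = (\<Sum>j = 0..n div 3. (P ^ (3 * j + 1)) $ (n - 3 * j))"
proof -
  define Z where "Z = fps_X ^ 3 * P ^ 3"
  have Z_power: "Z ^ j = fps_X ^ (3 * j) * P ^ (3 * j)" for j
    by (simp add: Z_def power_mult_distrib power_mult)
  define J where "J = n div 3"
  have B: "(1 - Z) * bottom_turns = 1"
    unfolding bottom_turns_def Z_def by (rule inverse_mult_eq_1') simp
  have "P * bottom_turns = P * ((1 - Z) * (\<Sum>j\<le>J. Z ^ j) + Z ^ Suc J) * bottom_turns"
    by (simp only: geometric_sum_split mult_1_right)
  also have "\<dots> = (\<Sum>j\<le>J. Z ^ j) * P * ((1 - Z) * bottom_turns) + Z ^ Suc J * (P * bottom_turns)"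
    by (simp only: algebra_simps)
  also have "\<dots> = (\<Sum>j\<le>J. fps_X ^ (3 * j) * P ^ (3 * j + 1)) + fps_X ^ (3 * Suc J) * (P ^ (3 * Suc J) * (P * bottom_turns))"
    unfolding B Z_power by (simp only: sum_distrib_right power_add power_one_right mult_1_right mult.assoc)
  finally have "P * bottom_turns = (\<Sum>j\<le>J. fps_X ^ (3 * j) * P ^ (3 * j + 1))
       + fps_X ^ (3 * Suc J) * (P ^ (3 * Suc J) * (P * bottom_turns))" .
  from arg_cong[OF this, of "\<lambda>F. F $ n"]
  have "(P * bottom_turns) $ n = (\<Sum>j\<le>J. (fps_X ^ (3 * j) * P ^ (3 * j + 1)) $ n)
       + (fps_X ^ (3 * Suc J) * (P ^ (3 * Suc J) * (P * bottom_turns))) $ n"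
    by (simp only: fps_add_nth fps_sum_nth)
  also have "(fps_X ^ (3 * Suc J) * (P ^ (3 * Suc J) * (P * bottom_turns))) $ n = 0"
    unfolding fps_X_power_mult_nth J_def by auto
  also have "(\<Sum>j\<le>J. (fps_X ^ (3 * j) * P ^ (3 * j + 1)) $ n) = (\<Sum>j = 0..J. (P ^ (3 * j + 1)) $ (n - 3 * j))"
    unfolding fps_X_power_mult_nth J_def by (intro sum.cong) auto
  finally show ?thesis by (simp add: J_def mult.assoc)
qed

theorem mainTheorem2:
  shows "(\<forall>k::nat. k \<ge> 1 \<longrightarrow> V k = ((Q - 1) * inverse P) * (1 - inverse P) ^ (k - 1)) \<and>
    V 1 = (Q - 1) * inverse P \<and>
    (Q - 1) * inverse P =
      Abs_fps (\<lambda>n::nat. if n = 0 then 0 else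
        (\<Sum>j = 0..(n - 1) div 3. \<Sum>k = 0..(n - 3 * j - 1) div 3.
          of_int (3 * int j + 1) / of_int (int n - int k)
          * of_nat (binom (int n - 3 * int j - 1 - 2 * int k - 1) (int k))
          * of_nat (binom (2 * int n - 4 * int k - 3 * int j - 2)
                          (int n - 3 * int k - 3 * int j - 1))))"
proof (intro conjI allI impI)
  fix k :: nat assume "k \<ge> 1"
  then obtain j where "k = Suc j" by (cases k) auto
  then show "V k = ((Q - 1) * inverse P) * (1 - inverse P) ^ (k - 1)"
    by (simp add: V_Suc Q_minus_1_over_P)
next
  show "V 1 = (Q - 1) * inverse P"
    using V_Suc[of 0] by (simp add: Q_minus_1_over_P)
next
  let ?t = "\<lambda>n j k. of_int (3 * int j + 1) / of_int (int n - int k)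
          * of_nat (binom (int n - 3 * int j - 1 - 2 * int k - 1) (int k))
          * of_nat (binom (2 * int n - 4 * int k - 3 * int j - 2)
                          (int n - 3 * int k - 3 * int j - 1)) :: rat"
  show "(Q - 1) * inverse P = Abs_fps (\<lambda>n. if n = 0 then 0 else
        (\<Sum>j = 0..(n - 1) div 3. \<Sum>k = 0..(n - 3 * j - 1) div 3. ?t n j k))"
    unfolding Q_minus_1_over_P
  proof (rule fps_ext)
    fix n
    show "(fps_X * P * bottom_turns) $ n = Abs_fps (\<lambda>n. if n = 0 then 0 else
        (\<Sum>j = 0..(n - 1) div 3. \<Sum>k = 0..(n - 3 * j - 1) div 3. ?t n j k)) $ n"
    proof (cases n)
      case 0 then show ?thesis by simp
    next
      case (Suc m)
      have "(P ^ (3 * j + 1)) $ (m - 3 * j) = (\<Sum>k = 0..(n - 3 * j - 1) div 3. ?t n j k)"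
        if "j \<in> {0..m div 3}" for j
      proof -
        define l where "l = m - 3 * j"
        have m: "m = l + 3 * j" using that by (auto simp: l_def)
        have e: "int l + int (3 * j + 1) - int k = int n - int k"
          "int l - 2 * int k - 1 = int n - 3 * int j - 1 - 2 * int k - 1"
          "2 * int l - 4 * int k + int (3 * j + 1) - 1 = 2 * int n - 4 * int k - 3 * int j - 2"
          "int l - 3 * int k = int n - 3 * int k - 3 * int j - 1" for k
          by (simp_all add: Suc m)
        have turn_factor: "int (3 * j + 1) = 3 * int j + 1" by simp
        have "(P ^ (3 * j + 1)) $ l = (\<Sum>k = 0..l div 3. ?t n j k)"
          unfolding P_power using lagrange_power_nth[of "3 * j + 1" l, unfolded e] unfolding turn_factor by simp
        moreover have "n - 3 * j - 1 = l" by (simp add: Suc m)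
        ultimately show ?thesis by (simp only: l_def)
      qed
      then show ?thesis unfolding Suc geometric_P_nth by (simp add: Suc)
    qed
  qed
qed

end
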